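(* Let $0<p\leq\frac13$ and let $n$ be a positive integer. Suppose that two families $\mathcal F,\mathcal G\subset 2^{[n]}$ are cross $2$-intersecting, i.e. $|F\cap G|\geq 2$ for all $F\in\mathcal F$, $G\in\mathcal G$. Then $\mu_p(\mathcal F)\mu_p(\mathcal G)\leq p^4$. Moreover, if $p<\frac13$ and $\mu_p(\mathcal F)\mu_p(\mathcal G)=p^4$, then $\mathcal F=\mathcal G=\{F\in 2^{[n]}:T\subset F\}$ for some $2$-element subset $T\subset[n]$.
   Context: $2^{[n]}$ is the power set of $[n]=\{1,\dots,n\}$. For $0<p<1$ and $\mathcal F\subset 2^{[n]}$, the product measure is $\mu_p(\mathcal F):=\sum_{F\in\mathcal F}p^{|F|}(1-p)^{n-|F|}$. *)

theory Defs
  imports Complex_Main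
begin

text \<open>
  Intended for \<open>\<F> \<subseteq> Pow {1..n}\<close>, where the sum is finite and the subtraction in the
  exponent does not truncate.
\<close>
definition product_measure :: "nat \<Rightarrow> real \<Rightarrow> nat set set \<Rightarrow> real" where
  "product_measure n p \<F> = (\<Sum>F\<in>\<F>. p ^ card F * (1 - p) ^ (n - card F))"

text \<open>
  Intended for families of finite sets, as \<open>card\<close> of an infinite set is \<open>0\<close>.
\<close>
definition cross_intersecting :: "nat \<Rightarrow> 'a set set \<Rightarrow> 'a set set \<Rightarrow> bool" where
  "cross_intersecting t \<F> \<G> \<longleftrightarrow> (\<forall>F\<in>\<F>. \<forall>G\<in>\<G>. t \<le> card (F \<inter> G))"

end

theory Submission
  imports Defs
begin

text \<open>
  For an up-closed family and \<open>s \<ge> 1\<close>, convexity of \<open>x \<mapsto> x powr s\<close> gives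
  \<open>\<mu>\<^sub>q(\<F>) \<le> \<mu>\<^sub>p(\<F>) powr s\<close> where \<open>q = p powr s\<close>, with equality for \<open>s > 1\<close> only for families
  \<open>{F. S \<subseteq> F}\<close>. Hence everything, uniqueness included, follows from the inequality at \<open>p = 1/3\<close>.

  At \<open>p = 1/3\<close> take a pair \<open>\<A>, \<B>\<close> on \<open>{1..n+1}\<close> of maximal product, stable under the shifts of \<open>n+1\<close> to
  smaller elements. Call a member of \<open>\<A>\<close> pivotal if it contains \<open>n+1\<close> and leaves \<open>\<A>\<close> when \<open>n+1\<close> is
  removed. Stability implies that pivotal sets of \<open>\<A>\<close> and \<open>\<B>\<close> meeting in exactly two elements cover
  \<open>{1..n+1}\<close>, so only complementary sizes are in conflict: one may remove \<open>n+1\<close> from the pivotal sets of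
  \<open>\<A>\<close> of one size at the price of deleting the pivotal sets of \<open>\<B>\<close> of the complementary size. By
  maximality this never gains, in either direction, which forces the pivotal sets to carry at least
  half of the weight. But the upper shadows of the pivotal sets consist of non-pivotal sets, and
  comparing the weights leaves finitely many small \<open>n\<close>. Without pivotal sets, \<open>n+1\<close> is irrelevant and
  induction applies.
\<close>

section \<open>Slices and weights\<close>

definition lo :: "nat \<Rightarrow> nat set set \<Rightarrow> nat set set" where
  "lo n \<A> = {F \<in> \<A>. Suc n \<notin> F}"

definition hi :: "nat \<Rightarrow> nat set set \<Rightarrow> nat set set" where
  "hi n \<A> = {F. Suc n \<notin> F \<and> insert (Suc n) F \<in> \<A>}"

lemma lo_subset: "\<A> \<subseteq> Pow {1..Suc n} \<Longrightarrow> lo n \<A> \<subseteq> Pow {1..n}"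
  unfolding lo_def by (simp add: atLeastAtMostSuc_conv) blast

lemma hi_subset: "\<A> \<subseteq> Pow {1..Suc n} \<Longrightarrow> hi n \<A> \<subseteq> Pow {1..n}"
  unfolding hi_def by (simp add: atLeastAtMostSuc_conv) blast

lemma lo_hi_decomp: "\<A> = lo n \<A> \<union> insert (Suc n) ` hi n \<A>"
proof (intro set_eqI iffI)
  fix F assume F: "F \<in> \<A>"
  show "F \<in> lo n \<A> \<union> insert (Suc n) ` hi n \<A>"
  proof (cases "Suc n \<in> F")
    case True
    then have "F = insert (Suc n) (F - {Suc n})" "F - {Suc n} \<in> hi n \<A>"
      using F by (auto simp: hi_def insert_absorb)
    then show ?thesis by blast
  qed (use F in \<open>simp add: lo_def\<close>)
qed (auto simp: lo_def hi_def)

lemma sum_lo_hi: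
  fixes f :: "nat set \<Rightarrow> 'b::comm_monoid_add"
  assumes "\<A> \<subseteq> Pow {1..Suc n}"
  shows "sum f \<A> = sum f (lo n \<A>) + sum (\<lambda>F. f (insert (Suc n) F)) (hi n \<A>)"
proof -
  have fin: "finite (lo n \<A>)" "finite (hi n \<A>)"
    using lo_subset[OF assms] hi_subset[OF assms] by (auto intro: finite_subset)
  have inj: "inj_on (insert (Suc n)) (hi n \<A>)"
    by (auto simp: inj_on_def hi_def insert_ident)
  have "sum f \<A> = sum f (lo n \<A> \<union> insert (Suc n) ` hi n \<A>)"
    using lo_hi_decomp[of \<A> n] by simp
  also have "\<dots> = sum f (lo n \<A>) + sum f (insert (Suc n) ` hi n \<A>)"
    by (rule sum.union_disjoint) (use fin in \<open>auto simp: lo_def hi_def\<close>)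
  also have "sum f (insert (Suc n) ` hi n \<A>) = sum (\<lambda>F. f (insert (Suc n) F)) (hi n \<A>)"
    by (simp add: sum.reindex[OF inj] o_def)
  finally show ?thesis .
qed

lemma Pow_card_props:
  assumes "F \<in> Pow {1..n::nat}"
  shows "finite F" "card F \<le> n" "Suc n \<notin> F" "card (insert (Suc n) F) = Suc (card F)"
proof -
  show f: "finite F" and "card F \<le> n" and s: "Suc n \<notin> F"
    using assms card_mono[of "{1..n}" F] by (auto intro: finite_subset)
  show "card (insert (Suc n) F) = Suc (card F)"
    using f s by simp
qed

lemma product_measure_Suc:
  assumes "\<A> \<subseteq> Pow {1..Suc n}"
  shows "product_measure (Suc n) p \<A> =
    (1 - p) * product_measure n p (lo n \<A>) + p * product_measure n p (hi n \<A>)"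
proof -
  have "(\<Sum>F\<in>lo n \<A>. p ^ card F * (1 - p) ^ (Suc n - card F)) =
      (1 - p) * product_measure n p (lo n \<A>)"
    unfolding product_measure_def sum_distrib_left
  proof (rule sum.cong)
    fix F assume "F \<in> lo n \<A>"
    then have "card F \<le> n" using lo_subset[OF assms] Pow_card_props(2) by blast
    then show "p ^ card F * (1 - p) ^ (Suc n - card F) = (1 - p) * (p ^ card F * (1 - p) ^ (n - card F))"
      by (simp add: Suc_diff_le)
  qed simp
  moreover have "(\<Sum>F\<in>hi n \<A>. p ^ card (insert (Suc n) F) * (1 - p) ^ (Suc n - card (insert (Suc n) F))) =
      p * product_measure n p (hi n \<A>)"
    unfolding product_measure_def sum_distrib_left
  proof (rule sum.cong)
    fix F assume "F \<in> hi n \<A>"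
    then have "F \<in> Pow {1..n}" using hi_subset[OF assms] by blast
    from Pow_card_props(4)[OF this]
    show "p ^ card (insert (Suc n) F) * (1 - p) ^ (Suc n - card (insert (Suc n) F)) =
        p * (p ^ card F * (1 - p) ^ (n - card F))"
      by simp
  qed simp
  ultimately show ?thesis
    unfolding product_measure_def by (subst sum_lo_hi[OF assms]) simp
qed

text \<open>The measure for \<open>p = 1/3\<close>, scaled by \<open>3 ^ n\<close> to be integral.\<close>

definition weight :: "nat \<Rightarrow> nat set set \<Rightarrow> nat" where
  "weight n \<A> = (\<Sum>F\<in>\<A>. 2 ^ (n - card F))"

lemma product_measure_third:
  assumes "\<A> \<subseteq> Pow {1..n}"
  shows "product_measure n (1/3) \<A> = weight n \<A> / 3 ^ n"
proof -
  have "(1/3::real) ^ card F * (1 - 1/3) ^ (n - card F) = 2 ^ (n - card F) / 3 ^ n" if "F \<in> \<A>" for F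
  proof -
    have "card F \<le> n" using that assms Pow_card_props(2) by blast
    then have "(3::real) ^ n = 3 ^ card F * 3 ^ (n - card F)"
      by (simp flip: power_add)
    then show ?thesis by (simp add: power_divide)
  qed
  then show ?thesis
    by (simp add: product_measure_def weight_def sum_divide_distrib)
qed

lemma weight_Suc:
  assumes "\<A> \<subseteq> Pow {1..Suc n}"
  shows "weight (Suc n) \<A> = 2 * weight n (lo n \<A>) + weight n (hi n \<A>)"
proof -
  have "(\<Sum>F\<in>lo n \<A>. 2 ^ (Suc n - card F)) = 2 * weight n (lo n \<A>)"
    unfolding weight_def sum_distrib_left
  proof (rule sum.cong)
    fix F assume "F \<in> lo n \<A>"
    then have "card F \<le> n" using lo_subset[OF assms] Pow_card_props(2) by blast
    then show "2 ^ (Suc n - card F) = (2::nat) * 2 ^ (n - card F)"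
      by (simp add: Suc_diff_le)
  qed simp
  moreover have "(\<Sum>F\<in>hi n \<A>. 2 ^ (Suc n - card (insert (Suc n) F))) = weight n (hi n \<A>)"
    unfolding weight_def
  proof (rule sum.cong)
    fix F assume "F \<in> hi n \<A>"
    then have "F \<in> Pow {1..n}" using hi_subset[OF assms] by blast
    from Pow_card_props(4)[OF this]
    show "(2::nat) ^ (Suc n - card (insert (Suc n) F)) = 2 ^ (n - card F)"
      by simp
  qed simp
  ultimately show ?thesis
    unfolding weight_def by (subst sum_lo_hi[OF assms]) simp
qed

lemma weight_mono: "finite \<B> \<Longrightarrow> \<A> \<subseteq> \<B> \<Longrightarrow> weight n \<A> \<le> weight n \<B>"
  unfolding weight_def by (rule sum_mono2) auto

lemma weight_union_disjoint:
  "finite \<A> \<Longrightarrow> finite \<B> \<Longrightarrow> \<A> \<inter> \<B> = {} \<Longrightarrow> weight n (\<A> \<union> \<B>) = weight n \<A> + weight n \<B>"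
  unfolding weight_def by (rule sum.union_disjoint)

lemma weight_Diff:
  assumes "finite \<B>" "\<A> \<subseteq> \<B>"
  shows "weight n (\<B> - \<A>) + weight n \<A> = weight n \<B>"
  using weight_union_disjoint[of "\<B> - \<A>" \<A> n] assms
  by (metis Diff_disjoint Diff_partition Int_commute Un_commute finite_Diff finite_subset)

lemma weight_eq_0_iff: "finite \<A> \<Longrightarrow> weight n \<A> = 0 \<longleftrightarrow> \<A> = {}"
  by (auto simp: weight_def)

lemma weight_uniform: "(\<And>F. F \<in> \<A> \<Longrightarrow> card F = i) \<Longrightarrow> weight n \<A> = card \<A> * 2 ^ (n - i)"
  by (simp add: weight_def)

section \<open>Shifting\<close>

definition shift_set :: "nat \<Rightarrow> nat \<Rightarrow> nat set \<Rightarrow> nat set" where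
  "shift_set k m F = (if m \<in> F \<and> k \<notin> F then insert k (F - {m}) else F)"

definition shift_in :: "nat \<Rightarrow> nat \<Rightarrow> nat set set \<Rightarrow> nat set \<Rightarrow> nat set" where
  "shift_in k m \<A> F = (if shift_set k m F \<in> \<A> then F else shift_set k m F)"

abbreviation shift :: "nat \<Rightarrow> nat \<Rightarrow> nat set set \<Rightarrow> nat set set" where
  "shift k m \<A> \<equiv> shift_in k m \<A> ` \<A>"

lemma card_shift_set: "finite F \<Longrightarrow> card (shift_set k m F) = card F"
  by (auto simp: shift_set_def card_Diff_singleton) (metis Suc_pred card_gt_0_iff empty_iff)

text \<open>A set that moves lands outside \<open>\<A>\<close>, so it cannot collide with one that
  stays, and a moved set determines its original by trading \<open>k\<close> back for
  \<open>m\<close>.\<close>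

lemma inj_on_shift_in: "inj_on (shift_in k m \<A>) \<A>"
proof (rule inj_onI)
  fix F G assume "F \<in> \<A>" "G \<in> \<A>" and eq: "shift_in k m \<A> F = shift_in k m \<A> G"
  then have "F = G \<or> shift_set k m F \<notin> \<A> \<and> shift_set k m G \<notin> \<A> \<and> shift_set k m F = shift_set k m G"
    by (auto simp: shift_in_def split: if_splits)
  moreover have "m \<in> H \<and> k \<notin> H \<and> H = insert m (shift_set k m H - {k})"
    if "shift_set k m H \<notin> \<A>" "H \<in> \<A>" for H
    using that by (auto simp: shift_set_def split: if_splits)
  ultimately show "F = G" using \<open>F \<in> \<A>\<close> \<open>G \<in> \<A>\<close> by metis
qed

lemma shift_subset:
  assumes "\<A> \<subseteq> Pow {1..n}" "k \<in> {1..n}"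
  shows "shift k m \<A> \<subseteq> Pow {1..n}"
proof -
  have "shift_in k m \<A> F \<subseteq> {1..n}" if "F \<in> \<A>" for F
  proof -
    have "F \<subseteq> {1..n}" using assms(1) that by blast
    then show ?thesis using assms(2) by (auto simp: shift_in_def shift_set_def)
  qed
  then show ?thesis by blast
qed

lemma weight_shift:
  assumes "\<A> \<subseteq> Pow {1..n}"
  shows "weight n (shift k m \<A>) = weight n \<A>"
proof -
  have "card (shift_in k m \<A> F) = card F" if "F \<in> \<A>" for F
  proof -
    have "finite F" using assms that Pow_card_props(1) by blast
    then show ?thesis by (simp add: shift_in_def card_shift_set)
  qed
  then show ?thesis
    by (simp add: weight_def sum.reindex[OF inj_on_shift_in] o_def)
qed

text \<open>The number of members through \<open>m\<close> is the potential that makes shifting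
  terminate: a set containing \<open>m\<close> after the shift stayed fixed, so every genuine move
  lowers the count.\<close>

lemma card_shift_containing:
  assumes "finite \<A>" "k \<noteq> m"
  shows "card {F \<in> shift k m \<A>. m \<in> F} \<le> card {F \<in> \<A>. m \<in> F}"
    and "F \<in> \<A> \<Longrightarrow> m \<in> F \<Longrightarrow> shift_set k m F \<notin> \<A> \<Longrightarrow>
      card {F \<in> shift k m \<A>. m \<in> F} < card {F \<in> \<A>. m \<in> F}"
proof -
  have sub: "{F \<in> shift k m \<A>. m \<in> F} \<subseteq> {F \<in> \<A>. m \<in> F \<and> shift_set k m F \<in> \<A>}"
    using assms(2) by (auto simp: shift_in_def shift_set_def split: if_splits)
  then show "card {F \<in> shift k m \<A>. m \<in> F} \<le> card {F \<in> \<A>. m \<in> F}"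
    using assms(1) by (intro card_mono) auto
  show "card {F \<in> shift k m \<A>. m \<in> F} < card {F \<in> \<A>. m \<in> F}"
    if "F \<in> \<A>" "m \<in> F" "shift_set k m F \<notin> \<A>"
    using assms(1) sub that by (intro psubset_card_mono) auto
qed

section \<open>Cross-intersection under shifting\<close>

lemma cross_intersecting_commute: "cross_intersecting t \<A> \<B> \<longleftrightarrow> cross_intersecting t \<B> \<A>"
  unfolding cross_intersecting_def by (metis Int_commute)

lemma cross_intersecting_shift_one_moved:
  assumes cross: "cross_intersecting t \<A> \<B>" and "finite F"
    and "F \<in> \<A>" "G \<in> \<B>" "shift_set k m F \<notin> \<A>" "shift_set k m G \<in> \<B>"
  shows "t \<le> card (shift_set k m F \<inter> G)"
proof -
  have F: "m \<in> F" "k \<notin> F" and sF: "shift_set k m F = insert k (F - {m})"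
    using assms by (auto simp: shift_set_def split: if_splits)
  have FG: "t \<le> card (F \<inter> G)" and FsG: "t \<le> card (F \<inter> shift_set k m G)"
    using assms by (auto simp: cross_intersecting_def)
  have fin: "finite (shift_set k m F \<inter> G)" using \<open>finite F\<close> by (simp add: sF)
  consider "m \<notin> G" | "m \<in> G" "k \<in> G" | "m \<in> G" "k \<notin> G" by blast
  then show ?thesis
  proof cases
    case 1
    then have "F \<inter> G \<subseteq> shift_set k m F \<inter> G" by (auto simp: sF)
    then show ?thesis using FG card_mono[OF fin] by (meson le_trans)
  next
    case 2
    then have "shift_set k m F \<inter> G = shift_set k m (F \<inter> G)"
      using F by (auto simp: shift_set_def)
    then show ?thesis using FG \<open>finite F\<close> by (simp add: card_shift_set)
  next
    \<comment> \<open>Moving \<open>F\<close> loses the common element \<open>m\<close>. But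
      \<open>G\<close> stays put only because its own shift is already in \<open>\<B>\<close>; the
      \<open>t\<close> elements that \<open>F\<close> shares with that shift avoid both
      \<open>m\<close> and \<open>k\<close>, so they survive.\<close>
    case 3
    then have "F \<inter> shift_set k m G \<subseteq> shift_set k m F \<inter> G"
      using F by (auto simp: shift_set_def)
    then show ?thesis using FsG card_mono[OF fin] by (meson le_trans)
  qed
qed

lemma cross_intersecting_shift:
  assumes cross: "cross_intersecting t \<A> \<B>"
    and fin: "\<And>F. F \<in> \<A> \<union> \<B> \<Longrightarrow> finite F"
  shows "cross_intersecting t (shift k m \<A>) (shift k m \<B>)"
proof -
  have "t \<le> card (shift_in k m \<A> F \<inter> shift_in k m \<B> G)" if F: "F \<in> \<A>" and G: "G \<in> \<B>" for F G
  proof -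
    have FG: "t \<le> card (F \<inter> G)" using cross F G by (auto simp: cross_intersecting_def)
    consider "shift_set k m F \<in> \<A>" "shift_set k m G \<in> \<B>"
      | "shift_set k m F \<notin> \<A>" "shift_set k m G \<in> \<B>"
      | "shift_set k m F \<in> \<A>" "shift_set k m G \<notin> \<B>"
      | "shift_set k m F \<notin> \<A>" "shift_set k m G \<notin> \<B>" by blast
    then show ?thesis
    proof cases
      case 1
      then show ?thesis using FG by (simp add: shift_in_def)
    next
      case 2
      then show ?thesis
        using cross_intersecting_shift_one_moved[OF cross _ F G] fin F by (simp add: shift_in_def)
    next
      case 3
      then show ?thesis
        using cross_intersecting_shift_one_moved[OF cross[THEN cross_intersecting_commute[THEN iffD1]] _ G F]
          fin G by (simp add: shift_in_def Int_commute)
    next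
      case 4
      \<comment> \<open>When both sets move, \<open>m\<close> is exchanged for \<open>k\<close> in
        the intersection as well, which keeps its size.\<close>
      then have "m \<in> F" "k \<notin> F" "m \<in> G" "k \<notin> G"
        using F G by (auto simp: shift_set_def split: if_splits)
      then have "shift_set k m F \<inter> shift_set k m G = shift_set k m (F \<inter> G)"
        by (auto simp: shift_set_def)
      then show ?thesis using FG 4 fin F by (simp add: shift_in_def card_shift_set)
    qed
  qed
  then show ?thesis by (auto simp: cross_intersecting_def)
qed

text \<open>Invariance under the shifts from \<open>Suc n\<close> to all smaller \<open>k\<close>,
  in terms of slices: if \<open>insert (Suc n) F\<close> is a member and \<open>k\<close> is
  missing, then \<open>Suc n\<close> may be replaced by \<open>k\<close>.\<close>

definition shift_stable :: "nat \<Rightarrow> nat set set \<Rightarrow> bool" where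
  "shift_stable n \<A> \<longleftrightarrow> (\<forall>F\<in>hi n \<A>. \<forall>k\<in>{1..n} - F. insert k F \<in> lo n \<A>)"

definition optimal :: "nat \<Rightarrow> nat set set \<Rightarrow> nat set set \<Rightarrow> bool" where
  "optimal n \<A> \<B> \<longleftrightarrow> \<A> \<subseteq> Pow {1..n} \<and> \<B> \<subseteq> Pow {1..n} \<and> cross_intersecting 2 \<A> \<B> \<and>
    (\<forall>\<A>' \<B>'. \<A>' \<subseteq> Pow {1..n} \<longrightarrow> \<B>' \<subseteq> Pow {1..n} \<longrightarrow> cross_intersecting 2 \<A>' \<B>' \<longrightarrow>
      weight n \<A>' * weight n \<B>' \<le> weight n \<A> * weight n \<B>)"

lemma optimal_commute: "optimal n \<A> \<B> \<Longrightarrow> optimal n \<B> \<A>"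
  unfolding optimal_def by (metis cross_intersecting_commute mult.commute)

text \<open>Among the finitely many pairs of maximal product, take one with the fewest members
  through \<open>Suc n\<close>, counted over both families. Shifting preserves weights and
  cross-intersection, so a shift that still moved a set would give another maximal pair with a
  smaller count.\<close>

lemma ex_optimal_stable:
  obtains \<A> \<B> where "optimal (Suc n) \<A> \<B>" "shift_stable n \<A>" "shift_stable n \<B>"
proof -
  let ?m = "Suc n"
  define P where "P = {(\<A>, \<B>). \<A> \<subseteq> Pow {1..?m} \<and> \<B> \<subseteq> Pow {1..?m} \<and> cross_intersecting 2 \<A> \<B>}"
  define w where "w = (\<lambda>(\<A>, \<B>). weight ?m \<A> * weight ?m \<B>)"
  define c where "c = (\<lambda>(\<A>, \<B>). card {F \<in> \<A>. ?m \<in> F} + card {F \<in> \<B>. ?m \<in> F})"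
  have "P \<subseteq> Pow (Pow {1..?m}) \<times> Pow (Pow {1..?m})" by (auto simp: P_def)
  then have finP: "finite P" by (rule finite_subset) simp
  have "({}, {}) \<in> P" by (simp add: P_def cross_intersecting_def)
  then have "w ` P \<noteq> {}" by blast
  define M where "M = Max (w ` P)"
  have M: "M \<in> w ` P" "\<And>x. x \<in> P \<Longrightarrow> w x \<le> M"
    using finP \<open>w ` P \<noteq> {}\<close> by (auto simp: M_def)
  then obtain x0 where "x0 \<in> P \<and> w x0 = M" by blast
  then obtain x where x: "x \<in> P \<and> w x = M" and min: "\<And>y. y \<in> P \<and> w y = M \<Longrightarrow> c x \<le> c y"
    using ex_has_least_nat[of "\<lambda>x. x \<in> P \<and> w x = M" x0 c] by blast
  obtain \<A> \<B> where xAB: "x = (\<A>, \<B>)" by (cases x)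
  have sub: "\<A> \<subseteq> Pow {1..?m}" "\<B> \<subseteq> Pow {1..?m}" and cross: "cross_intersecting 2 \<A> \<B>"
    using x by (auto simp: P_def xAB)
  have fin: "finite \<A>" "finite \<B>" using sub by (auto intro: finite_subset)
  have "optimal ?m \<A> \<B>"
    unfolding optimal_def using sub cross M(2) x by (auto simp: P_def w_def xAB)
  have stb: "shift_set k ?m F \<in> \<H>"
    if H: "\<H> = \<A> \<or> \<H> = \<B>" and F: "F \<in> \<H>" "?m \<in> F" and k: "k \<in> {1..n}" for \<H> F k
  proof (rule ccontr)
    assume no: "shift_set k ?m F \<notin> \<H>"
    have k': "k \<in> {1..?m}" "k \<noteq> ?m" using k by auto
    let ?y = "(shift k ?m \<A>, shift k ?m \<B>)"
    have "finite F" if "F \<in> \<A> \<union> \<B>" for F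
    proof -
      have "F \<in> Pow {1..?m}" using that sub by blast
      then show ?thesis by (rule Pow_card_props(1))
    qed
    then have "?y \<in> P"
      using shift_subset[OF sub(1) k'(1)] shift_subset[OF sub(2) k'(1)]
        cross_intersecting_shift[OF cross] by (simp add: P_def)
    moreover have "w ?y = M"
      using x weight_shift sub by (simp add: w_def xAB)
    ultimately have "c x \<le> c ?y" using min by blast
    moreover have "c ?y < c x"
      using H
    proof
      assume "\<H> = \<A>"
      with F no show ?thesis
        unfolding c_def xAB prod.case
        by (intro add_less_le_mono card_shift_containing fin k'(2)) simp_all
    next
      assume "\<H> = \<B>"
      with F no show ?thesis
        unfolding c_def xAB prod.case
        by (intro add_le_less_mono card_shift_containing fin k'(2)) simp_all
    qed
    ultimately show False by simp
  qed
  have "shift_stable n \<H>" if H: "\<H> = \<A> \<or> \<H> = \<B>" for \<H>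
    unfolding shift_stable_def
  proof (intro ballI)
    fix F k assume F: "F \<in> hi n \<H>" and k: "k \<in> {1..n} - F"
    have "shift_set k ?m (insert ?m F) \<in> \<H>"
      using stb[OF H, of "insert ?m F" k] F k by (auto simp: hi_def)
    moreover have "shift_set k ?m (insert ?m F) = insert k F"
      using F k by (auto simp: shift_set_def hi_def)
    ultimately show "insert k F \<in> lo n \<H>"
      using F k by (auto simp: lo_def hi_def)
  qed
  with \<open>optimal ?m \<A> \<B>\<close> that show ?thesis by blast
qed

section \<open>Pushing pivotal sets\<close>

lemma cross_intersectingD: "cross_intersecting t \<A> \<B> \<Longrightarrow> F \<in> \<A> \<Longrightarrow> G \<in> \<B> \<Longrightarrow> t \<le> card (F \<inter> G)"
  by (simp add: cross_intersecting_def)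

lemma optimalD:
  assumes "optimal n \<A> \<B>"
  shows "\<A> \<subseteq> Pow {1..n}" "\<B> \<subseteq> Pow {1..n}" "cross_intersecting 2 \<A> \<B>"
  using assms by (auto simp: optimal_def)

lemma optimal_le:
  assumes "optimal n \<A> \<B>" "\<A>' \<subseteq> Pow {1..n}" "\<B>' \<subseteq> Pow {1..n}" "cross_intersecting 2 \<A>' \<B>'"
  shows "weight n \<A>' * weight n \<B>' \<le> weight n \<A> * weight n \<B>"
  using assms by (simp add: optimal_def)

text \<open>Adding \<open>Suc n\<close> to a member of \<open>\<A>\<close> cannot shrink
  intersections, so a missing superset could be adjoined to \<open>\<A>\<close>. This increases the
  product strictly because \<open>\<B>\<close> has positive weight.\<close>

lemma lo_subset_hi:
  assumes opt: "optimal (Suc n) \<A> \<B>" and pos: "0 < weight (Suc n) \<B>"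
  shows "lo n \<A> \<subseteq> hi n \<A>"
proof (rule subsetI, rule ccontr)
  fix F assume F: "F \<in> lo n \<A>" "F \<notin> hi n \<A>"
  have sub: "\<A> \<subseteq> Pow {1..Suc n}" "\<B> \<subseteq> Pow {1..Suc n}" and cross: "cross_intersecting 2 \<A> \<B>"
    using optimalD[OF opt] .
  let ?F = "insert (Suc n) F"
  have new: "?F \<notin> \<A>" and FA: "F \<in> \<A>" using F by (auto simp: hi_def lo_def)
  have F_sub: "?F \<subseteq> {1..Suc n}" using FA sub(1) by auto
  then have finF: "finite ?F" by (rule finite_subset) simp
  have "2 \<le> card (?F \<inter> G)" if "G \<in> \<B>" for G
  proof -
    have "2 \<le> card (F \<inter> G)" using cross FA that by (rule cross_intersectingD)
    also have "\<dots> \<le> card (?F \<inter> G)" using finF by (intro card_mono) auto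
    finally show ?thesis .
  qed
  then have "cross_intersecting 2 (insert ?F \<A>) \<B>"
    using cross by (auto simp: cross_intersecting_def)
  then have "weight (Suc n) (insert ?F \<A>) * weight (Suc n) \<B> \<le> weight (Suc n) \<A> * weight (Suc n) \<B>"
    using F_sub sub by (intro optimal_le[OF opt]) auto
  then have "weight (Suc n) (insert ?F \<A>) \<le> weight (Suc n) \<A>" using pos by simp
  moreover have "finite \<A>" using sub(1) by (auto intro: finite_subset)
  ultimately show False using new by (simp add: weight_def)
qed

text \<open>Pivotal sets, listed without their element \<open>Suc n\<close>; sizes \<open>i\<close> and \<open>j\<close> are in conflict if
  \<open>i + j = Suc n\<close>.\<close>

definition piv :: "nat \<Rightarrow> nat \<Rightarrow> nat set set \<Rightarrow> nat set set" where
  "piv n i \<A> = {F \<in> hi n \<A> - lo n \<A>. card F = i}"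

lemma piv_subset: "\<A> \<subseteq> Pow {1..Suc n} \<Longrightarrow> piv n i \<A> \<subseteq> Pow {1..n}"
  using hi_subset[of \<A> n] by (auto simp: piv_def)

lemma finite_piv: "\<A> \<subseteq> Pow {1..Suc n} \<Longrightarrow> finite (piv n i \<A>)"
  by (rule finite_subset[OF piv_subset]) simp_all

lemma push_cross_intersecting:
  assumes sub: "\<A> \<subseteq> Pow {1..Suc n}" "\<B> \<subseteq> Pow {1..Suc n}"
    and cross: "cross_intersecting 2 \<A> \<B>" and st: "shift_stable n \<A>" and ij: "i + j = Suc n"
  shows "cross_intersecting 2 (\<A> \<union> piv n i \<A>) (\<B> - insert (Suc n) ` piv n j \<B>)"
proof -
  have "2 \<le> card (F \<inter> G)"
    if F: "F \<in> piv n i \<A>" and G: "G \<in> \<B>" "G \<notin> insert (Suc n) ` piv n j \<B>" for F G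
  proof (cases "Suc n \<in> G")
    case False
    then have "insert (Suc n) F \<inter> G = F \<inter> G" by auto
    then show ?thesis using cross_intersectingD[OF cross _ G(1), of "insert (Suc n) F"] F
      by (simp add: piv_def hi_def)
  next
    case True
    define G' where "G' = G - {Suc n}"
    have G_eq: "G = insert (Suc n) G'" and nG': "Suc n \<notin> G'" using True by (auto simp: G'_def)
    have G'hi: "G' \<in> hi n \<B>" using G(1) nG' by (simp add: hi_def G_eq)
    have F_hi: "F \<in> hi n \<A>" "card F = i" and nF: "Suc n \<notin> F" and FA: "insert (Suc n) F \<in> \<A>"
      using F by (auto simp: piv_def hi_def)
    have Fn: "F \<subseteq> {1..n}" and Gn: "G' \<subseteq> {1..n}"
      using F_hi(1) G'hi hi_subset[OF sub(1)] hi_subset[OF sub(2)] by blast+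
    have fin: "finite F" "finite G'" using Fn Gn by (auto intro: finite_subset)
    have int: "F \<inter> G = F \<inter> G'" using nF by (auto simp: G'_def)
    show ?thesis
    proof (rule ccontr)
      assume small: "\<not> 2 \<le> card (F \<inter> G)"
      \<comment> \<open>Otherwise \<open>G'\<close> is itself in \<open>\<B>\<close>, and its
        intersection with \<open>insert (Suc n) F\<close> is already \<open>F \<inter> G\<close>. So
        \<open>G'\<close> is pivotal, and since \<open>G\<close> was not deleted, its size is not
        \<open>j\<close>.\<close>
      have "G' \<notin> lo n \<B>"
      proof
        assume "G' \<in> lo n \<B>"
        then have "2 \<le> card (insert (Suc n) F \<inter> G')"
          using cross_intersectingD[OF cross FA, of G'] by (simp add: lo_def)
        moreover have "insert (Suc n) F \<inter> G' = F \<inter> G" using nG' int by auto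
        ultimately show False using small by simp
      qed
      then have neq: "card G' \<noteq> j" using G(2) G'hi by (auto simp: piv_def G_eq)
      have "2 \<le> card (insert (Suc n) F \<inter> G)" using cross_intersectingD[OF cross FA G(1)] .
      moreover have "insert (Suc n) F \<inter> G = insert (Suc n) (F \<inter> G')" using nF by (auto simp: G'_def True)
      ultimately have one: "card (F \<inter> G') = 1"
        using small int fin nF by simp
      \<comment> \<open>\<open>F\<close> and \<open>G'\<close> share exactly one element. An element
        \<open>k\<close> outside both could replace \<open>Suc n\<close> in
        \<open>insert (Suc n) F\<close> by stability, and the result would meet \<open>G\<close> in
        that one element only. Hence \<open>F\<close> and \<open>G'\<close> cover
        \<open>{1..n}\<close> and their sizes sum to \<open>Suc n\<close>, the excluded
        case.\<close>
      have "k \<in> F \<union> G'" if k: "k \<in> {1..n}" for k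
      proof (rule ccontr)
        assume no: "k \<notin> F \<union> G'"
        then have "insert k F \<in> \<A>" using st F_hi k by (auto simp: shift_stable_def lo_def)
        then have "2 \<le> card (insert k F \<inter> G)" using cross G(1) by (blast intro: cross_intersectingD)
        moreover have "insert k F \<inter> G = F \<inter> G'" using no nF k by (auto simp: G'_def)
        ultimately show False using one by simp
      qed
      then have "F \<union> G' = {1..n}" using Fn Gn by blast
      then have "card F + card G' = n + 1" using card_Un_Int[OF fin] one by simp
      then show False using neq ij F_hi by simp
    qed
  qed
  then show ?thesis using cross by (auto simp: cross_intersecting_def)
qed

text \<open>Dropping \<open>Suc n\<close> from a set doubles its weight in dimension
  \<open>Suc n\<close>, hence a push gains twice \<open>weight n\<close> of the pivotal part, while
  deleting pivotal sets costs it once.\<close>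

lemma push_weight:
  assumes sub: "\<A> \<subseteq> Pow {1..Suc n}"
  shows "weight (Suc n) (\<A> \<union> piv n i \<A>) = weight (Suc n) \<A> + 2 * weight n (piv n i \<A>)"
    and "weight (Suc n) (\<A> - insert (Suc n) ` piv n i \<A>) + weight n (piv n i \<A>) = weight (Suc n) \<A>"
proof -
  have finA: "finite \<A>" using sub by (auto intro: finite_subset)
  note fin = finA finite_piv[OF sub, of i]
  have psub: "piv n i \<A> \<subseteq> Pow {1..Suc n}" using piv_subset[OF sub, of i] by fastforce
  have "lo n (piv n i \<A>) = piv n i \<A>" "hi n (piv n i \<A>) = {}"
    by (auto simp: piv_def lo_def hi_def)
  then have "weight (Suc n) (piv n i \<A>) = 2 * weight n (piv n i \<A>)"
    using weight_Suc[OF psub] by (simp add: weight_def)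
  moreover have "\<A> \<inter> piv n i \<A> = {}" by (auto simp: piv_def lo_def hi_def)
  ultimately show "weight (Suc n) (\<A> \<union> piv n i \<A>) = weight (Suc n) \<A> + 2 * weight n (piv n i \<A>)"
    using fin by (simp add: weight_union_disjoint)
  have isub: "insert (Suc n) ` piv n i \<A> \<subseteq> \<A>" by (auto simp: piv_def hi_def)
  have "lo n (insert (Suc n) ` piv n i \<A>) = {}" by (auto simp: lo_def)
  moreover have "hi n (insert (Suc n) ` piv n i \<A>) = piv n i \<A>"
    by (auto simp: piv_def hi_def insert_ident)
  ultimately have "weight (Suc n) (insert (Suc n) ` piv n i \<A>) = weight n (piv n i \<A>)"
    using weight_Suc[OF subset_trans[OF isub sub]] by (simp add: weight_def)
  then show "weight (Suc n) (\<A> - insert (Suc n) ` piv n i \<A>) + weight n (piv n i \<A>) = weight (Suc n) \<A>"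
    using weight_Diff[OF fin(1) isub, of "Suc n"] by simp
qed

lemma push_le:
  assumes opt: "optimal (Suc n) \<A> \<B>" and st: "shift_stable n \<A>" and ij: "i + j = Suc n"
  shows "2 * weight n (piv n i \<A>) * weight (Suc n) \<B> \<le>
    weight (Suc n) \<A> * weight n (piv n j \<B>) + 2 * weight n (piv n i \<A>) * weight n (piv n j \<B>)"
proof -
  have sub: "\<A> \<subseteq> Pow {1..Suc n}" "\<B> \<subseteq> Pow {1..Suc n}" and cross: "cross_intersecting 2 \<A> \<B>"
    using optimalD[OF opt] .
  have psub: "piv n i \<A> \<subseteq> Pow {1..Suc n}" using piv_subset[OF sub(1), of i] by fastforce
  let ?B = "\<B> - insert (Suc n) ` piv n j \<B>"
  \<comment> \<open>With \<open>x\<close>, \<open>y\<close> for the weights of the families and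
    \<open>a\<close>, \<open>b\<close> for those of their pivotal parts, this reads (x + 2a)(y - b)
    \<le> xy; the claim is its expansion.\<close>
  have "weight (Suc n) (\<A> \<union> piv n i \<A>) * weight (Suc n) ?B \<le> weight (Suc n) \<A> * weight (Suc n) \<B>"
    using push_cross_intersecting[OF sub cross st ij] sub psub by (intro optimal_le[OF opt]) auto
  then have "(weight (Suc n) \<A> + 2 * weight n (piv n i \<A>)) * weight (Suc n) ?B
      \<le> weight (Suc n) \<A> * weight (Suc n) \<B>"
    by (simp only: push_weight(1)[OF sub(1)])
  moreover have "weight (Suc n) \<B> = weight (Suc n) ?B + weight n (piv n j \<B>)"
    using push_weight(2)[OF sub(2)] by simp
  ultimately show ?thesis by (simp add: algebra_simps)
qed

text \<open>At an optimum neither direction of pushing gains, so both pivotal parts carry at least half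
  of the weight of their families.\<close>

lemma piv_half:
  assumes opt: "optimal (Suc n) \<A> \<B>" and st: "shift_stable n \<A>" "shift_stable n \<B>"
    and pos: "0 < weight (Suc n) \<A>" "0 < weight (Suc n) \<B>"
    and F: "piv n i \<A> \<noteq> {}" and ij: "i + j = Suc n"
  shows "weight (Suc n) \<A> \<le> 2 * weight n (piv n i \<A>)"
    and "weight (Suc n) \<B> \<le> 2 * weight n (piv n j \<B>)"
proof -
  define x y a b where defs: "x = int (weight (Suc n) \<A>)" "y = int (weight (Suc n) \<B>)"
    "a = int (weight n (piv n i \<A>))" "b = int (weight n (piv n j \<B>))"
  have sub: "\<A> \<subseteq> Pow {1..Suc n}" using optimalD(1)[OF opt] .
  have a: "0 < a" using weight_eq_0_iff[OF finite_piv[OF sub], of n i] F by (simp add: defs)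
  have p: "0 < x" "0 < y" "0 \<le> b" using pos by (simp_all add: defs)
  have ji: "j + i = Suc n" using ij by simp
  have 1: "2 * a * y \<le> x * b + 2 * a * b"
    using of_nat_mono[OF push_le[OF opt st(1) ij], where 'a = int] by (simp add: defs)
  have 2: "2 * b * x \<le> y * a + 2 * b * a"
    using of_nat_mono[OF push_le[OF optimal_commute[OF opt] st(2) ji], where 'a = int] by (simp add: defs)
  \<comment> \<open>Twice the first inequality plus the second eliminates \<open>x\<close>; below,
    twice the second plus the first eliminates \<open>y\<close>. Positivity of \<open>b\<close> is
    not assumed but follows from y \<le> 2b.\<close>
  have "(3 * a) * y \<le> (3 * a) * (2 * b)" using 1 2 by (simp add: algebra_simps)
  then have y: "y \<le> 2 * b" using a by simp
  then have b: "0 < b" using p by linarith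
  have "(3 * b) * x \<le> (3 * b) * (2 * a)" using 1 2 by (simp add: algebra_simps)
  then have "x \<le> 2 * a" using b by simp
  with y show "weight (Suc n) \<A> \<le> 2 * weight n (piv n i \<A>)"
    "weight (Suc n) \<B> \<le> 2 * weight n (piv n j \<B>)" by (simp_all add: defs)
qed

lemma weight_lo_hi:
  assumes "\<A> \<subseteq> Pow {1..Suc n}" "lo n \<A> \<subseteq> hi n \<A>"
  shows "weight (Suc n) \<A> = 3 * weight n (lo n \<A>) + weight n (hi n \<A> - lo n \<A>)"
  using weight_Suc[OF assms(1)] weight_Diff[OF _ assms(2), of n]
    finite_subset[OF hi_subset[OF assms(1)]] by simp

text \<open>Two different sizes would each carry half of the weight and leave nothing for
  \<open>lo n \<A>\<close>. With that slice empty, stability allows only \<open>{1..n}\<close> in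
  \<open>hi n \<A>\<close>, so there is just one size after all.\<close>

lemma piv_single_size:
  assumes opt: "optimal (Suc n) \<A> \<B>" and st: "shift_stable n \<A>" "shift_stable n \<B>"
    and pos: "0 < weight (Suc n) \<A>" "0 < weight (Suc n) \<B>"
    and FF: "F \<in> hi n \<A> - lo n \<A>" "F' \<in> hi n \<A> - lo n \<A>"
  shows "card F' = card F"
proof (rule ccontr)
  assume neq: "card F' \<noteq> card F"
  have sub: "\<A> \<subseteq> Pow {1..Suc n}" using optimalD(1)[OF opt] .
  have fin: "finite (hi n \<A>)" "finite (lo n \<A>)"
    using finite_subset[OF hi_subset[OF sub]] finite_subset[OF lo_subset[OF sub]] by auto
  have Fsub: "F \<in> Pow {1..n}" "F' \<in> Pow {1..n}" using FF hi_subset[OF sub] by auto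
  have half: "weight (Suc n) \<A> \<le> 2 * weight n (piv n (card H) \<A>)" if "H \<in> hi n \<A> - lo n \<A>" for H
  proof (rule piv_half(1)[OF opt st pos])
    show "piv n (card H) \<A> \<noteq> {}" using that by (auto simp: piv_def)
    have "H \<in> Pow {1..n}" using that hi_subset[OF sub] by auto
    from Pow_card_props(2)[OF this] show "card H + (Suc n - card H) = Suc n" by simp
  qed
  have "weight n (piv n (card F) \<A>) + weight n (piv n (card F') \<A>) =
      weight n (piv n (card F) \<A> \<union> piv n (card F') \<A>)"
    using neq by (intro weight_union_disjoint[symmetric] finite_piv[OF sub]) (auto simp: piv_def)
  also have "\<dots> \<le> weight n (hi n \<A> - lo n \<A>)"
    using fin by (intro weight_mono) (auto simp: piv_def)
  finally have "weight n (lo n \<A>) = 0"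
    using half[OF FF(1)] half[OF FF(2)] weight_lo_hi[OF sub lo_subset_hi[OF opt pos(2)]] by linarith
  then have lo: "lo n \<A> = {}" using weight_eq_0_iff fin by blast
  have "H = {1..n}" if "H \<in> hi n \<A>" "H \<in> Pow {1..n}" for H
    using that st(1) lo by (auto simp: shift_stable_def)
  then show False using FF Fsub neq by blast
qed

section \<open>Upper shadows\<close>

lemma upper_shadow_card:
  assumes "finite \<L>" and D: "\<D> \<subseteq> {F \<in> Pow {1..n::nat}. card F = i}"
    and up: "\<And>F k. F \<in> \<D> \<Longrightarrow> k \<in> {1..n} - F \<Longrightarrow> insert k F \<in> \<L>"
  shows "card \<D> * (n - i) \<le> card {F \<in> \<L>. card F = Suc i} * Suc i"
proof -
  let ?U = "{F \<in> \<L>. card F = Suc i}"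
  have Dp: "finite F \<and> F \<subseteq> {1..n} \<and> card F = i" if "F \<in> \<D>" for F
  proof -
    have "F \<subseteq> {1..n}" "card F = i" using D that by auto
    then show ?thesis using finite_subset[of F "{1..n}"] by simp
  qed
  have "finite \<D>" using D by (auto intro: finite_subset)
  have "card \<D> * (n - i) = (\<Sum>F\<in>\<D>. card ({1..n} - F))"
    using Dp by (simp add: card_Diff_subset)
  also have "\<dots> = card (SIGMA F:\<D>. {1..n} - F)"
    using \<open>finite \<D>\<close> by (simp add: card_SigmaI)
  also have "\<dots> \<le> card (SIGMA F:?U. F)"
  proof (rule card_inj_on_le)
    \<comment> \<open>Double counting: a pair of a set in \<open>\<D>\<close> and a missing element
      becomes a pair of a set one level higher and one of its elements.\<close>
    show "inj_on (\<lambda>(F, k). (insert k F, k)) (SIGMA F:\<D>. {1..n} - F)"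
      by (auto simp: inj_on_def insert_ident)
    show "(\<lambda>(F, k). (insert k F, k)) ` (SIGMA F:\<D>. {1..n} - F) \<subseteq> (SIGMA F:?U. F)"
      using up Dp by auto
    show "finite (SIGMA F:?U. F)"
      using \<open>finite \<L>\<close> by (intro finite_SigmaI) (auto intro: card_ge_0_finite)
  qed
  also have "\<dots> = (\<Sum>F\<in>?U. card F)"
    using \<open>finite \<L>\<close> by (intro card_SigmaI) (auto intro: card_ge_0_finite)
  also have "\<dots> = card ?U * Suc i" by simp
  finally show ?thesis .
qed

text \<open>Keeps only the two levels directly above \<open>\<D>\<close>: \<open>u\<close> and
  \<open>v\<close> count the members of \<open>\<L>\<close> of sizes i + 1 and i + 2. In the
  application \<open>\<L>\<close> is the lower slice and \<open>\<D>\<close> the pivotal sets, and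
  the hypothesis \<open>le\<close> says that the pivotal sets carry at least half of the total 3 *
  weight n \<L> + weight n \<D>.\<close>

lemma level_bounds:
  assumes L: "\<L> \<subseteq> Pow {1..n}" and D: "\<D> \<subseteq> {F \<in> Pow {1..n}. card F = i}" "\<D> \<noteq> {}"
    and up: "\<forall>F\<in>\<D> \<union> \<L>. \<forall>k\<in>{1..n} - F. insert k F \<in> \<L>"
    and le: "3 * weight n \<L> \<le> weight n \<D>"
  obtains d u v where "0 < d" "d \<le> n choose i" "weight n \<D> = d * 2 ^ (n - i)"
    "d * (n - i) \<le> u * Suc i" "u * (n - Suc i) \<le> v * Suc (Suc i)"
    "3 * (u * 2 ^ (n - Suc i) + v * 2 ^ (n - Suc (Suc i))) \<le> d * 2 ^ (n - i)"
proof
  let ?U = "\<lambda>k. {F \<in> \<L>. card F = k}"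
  have fin: "finite \<D>" "finite \<L>" using L D by (auto intro: finite_subset)
  show "0 < card \<D>" using fin D by (simp add: card_gt_0_iff)
  have "card \<D> \<le> card {F. F \<subseteq> {1..n} \<and> card F = i}" using D by (intro card_mono) auto
  then show "card \<D> \<le> n choose i" by (simp add: n_subsets)
  show wD: "weight n \<D> = card \<D> * 2 ^ (n - i)" using D by (intro weight_uniform) auto
  show "card \<D> * (n - i) \<le> card (?U (Suc i)) * Suc i"
    using fin D up by (intro upper_shadow_card) auto
  have "card (?U (Suc i)) * (n - Suc i) \<le> card {F \<in> \<L>. card F = Suc (Suc i)} * Suc (Suc i)"
    using fin L up by (intro upper_shadow_card) auto
  then show "card (?U (Suc i)) * (n - Suc i) \<le> card (?U (Suc (Suc i))) * Suc (Suc i)" .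
  have "card (?U (Suc i)) * 2 ^ (n - Suc i) + card (?U (Suc (Suc i))) * 2 ^ (n - Suc (Suc i))
      = weight n (?U (Suc i)) + weight n (?U (Suc (Suc i)))"
    by (subst (1 2) weight_uniform) auto
  also have "\<dots> = weight n (?U (Suc i) \<union> ?U (Suc (Suc i)))"
    using fin by (intro weight_union_disjoint[symmetric]) auto
  also have "\<dots> \<le> weight n \<L>" using fin by (intro weight_mono) auto
  finally show "3 * (card (?U (Suc i)) * 2 ^ (n - Suc i) + card (?U (Suc (Suc i))) * 2 ^ (n - Suc (Suc i)))
      \<le> card \<D> * 2 ^ (n - i)"
    using le wD by (metis (no_types, lifting) le_trans mult_le_mono2)
qed

text \<open>The full set has weight 1 and every other set an even weight. This parity supplies the
  last unit needed for a sharp bound in dimension 3.\<close>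

lemma weight_odd:
  assumes "\<L> \<subseteq> Pow {1..n}" "{1..n} \<in> \<L>"
  shows "odd (weight n \<L>)"
proof -
  have fin: "finite \<L>" using assms by (auto intro: finite_subset)
  have "weight n \<L> = weight n {{1..n}} + weight n (\<L> - {{1..n}})"
    using weight_Diff[of \<L> "{{1..n}}" n] fin assms(2) by simp
  moreover have "even (weight n (\<L> - {{1..n}}))"
    unfolding weight_def
  proof (rule dvd_sum)
    fix F assume "F \<in> \<L> - {{1..n}}"
    then have "F \<subset> {1..n}" using assms(1) by auto
    then have "card F < n" using psubset_card_mono[of "{1..n}" F] by simp
    then show "even (2 ^ (n - card F) :: nat)" by simp
  qed
  ultimately show ?thesis by (simp add: weight_def)
qed

section \<open>The case \<open>p = 1/3\<close>\<close>

text \<open>Level i + 1 alone decides: the weights give 3u \<le> 2d and the shadow gives d(n - i)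
  \<le> u(i + 1), so 3(n - i) \<le> 2(i + 1). Here \<open>v\<close> absorbs the contribution of the
  next level.\<close>

lemma level_size:
  assumes "0 < d" "i \<le> n" "d * (n - i) \<le> u * Suc i" "3 * (u * 2 ^ (n - Suc i) + v) \<le> d * 2 ^ (n - i)"
  shows "3 * n \<le> 5 * i + 2"
proof (cases "i = n")
  case False
  then have "(2::nat) ^ (n - i) = 2 * 2 ^ (n - Suc i)"
    using assms(2) by (simp add: Suc_diff_Suc flip: power_Suc)
  then have "(3 * u) * 2 ^ (n - Suc i) \<le> (2 * d) * 2 ^ (n - Suc i)"
    using assms(4) unfolding distrib_left by (simp only: mult_ac)
  then have "3 * u \<le> 2 * d" by simp
  then have "(3 * u) * Suc i \<le> (2 * d) * Suc i" by (rule mult_le_mono1)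
  then have "d * (3 * (n - i)) \<le> d * (2 * Suc i)"
    using assms(3) by (simp add: algebra_simps)
  then have "3 * (n - i) \<le> 2 * Suc i" using assms(1) by (simp only: mult_le_cancel1)
  then show ?thesis using assms(2) by simp
qed simp

text \<open>The bounds are tailored to the products needed in \<open>pivotal_case\<close>: 1 * 1, 1
  * 7, 9 * 9 and 80 * 80 must not exceed \<open>9 ^ Suc n\<close> / 81, which is 1, 9, 81 and 6561
  for n = 1, 2, 3, 5.\<close>

lemma level_weight:
  assumes L: "\<L> \<subseteq> Pow {1..n}" and D: "\<D> \<subseteq> {F \<in> Pow {1..n}. card F = i}" "\<D> \<noteq> {}"
    and up: "\<forall>F\<in>\<D> \<union> \<L>. \<forall>k\<in>{1..n} - F. insert k F \<in> \<L>"
    and le: "3 * weight n \<L> \<le> weight n \<D>"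
  shows "3 * n \<le> 5 * i + 2"
    and "(n, i) \<notin> {(9, 5), (7, 4), (4, 2)}"
    and "(n, i) = (5, 3) \<Longrightarrow> 3 * weight n \<L> + weight n \<D> \<le> 80"
    and "(n, i) = (3, 2) \<Longrightarrow> 3 * weight n \<L> + weight n \<D> \<le> 9"
    and "(n, i) = (2, 1) \<Longrightarrow> 3 * weight n \<L> + weight n \<D> \<le> 7"
    and "(n, i) \<in> {(1, 1), (2, 2)} \<Longrightarrow> 3 * weight n \<L> + weight n \<D> \<le> 1"
proof -
  obtain d u v where d: "0 < d" "d \<le> n choose i" "weight n \<D> = d * 2 ^ (n - i)"
    and duv: "d * (n - i) \<le> u * Suc i" "u * (n - Suc i) \<le> v * Suc (Suc i)"
      "3 * (u * 2 ^ (n - Suc i) + v * 2 ^ (n - Suc (Suc i))) \<le> d * 2 ^ (n - i)"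
    using level_bounds[OF assms] .
  obtain F where F: "F \<in> \<D>" "F \<in> Pow {1..n}" "card F = i" using D by blast
  then have "i \<le> n" using Pow_card_props(2) by blast
  with d duv show "3 * n \<le> 5 * i + 2" by (intro level_size)
  \<comment> \<open>These pairs satisfy the size bound from level i + 1; the additional weight on
    level i + 2 rules them out.\<close>
  show "(n, i) \<notin> {(9, 5), (7, 4), (4, 2)}"
    using d(1) duv by auto
  \<comment> \<open>At most 10 sets of weight 4 lie in \<open>\<D>\<close>, and the total is at most
    twice the weight of \<open>\<D>\<close>.\<close>
  show "3 * weight n \<L> + weight n \<D> \<le> 80" if "(n, i) = (5, 3)"
    using that d le by (simp add: numeral_eq_Suc)
  show "3 * weight n \<L> + weight n \<D> \<le> 7" if "(n, i) = (2, 1)"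
  proof -
    have D4: "weight n \<D> \<le> 4" using that d by simp
    with le have "weight n \<L> \<le> 1" by simp
    with D4 show ?thesis by linarith
  qed
  show "3 * weight n \<L> + weight n \<D> \<le> 1" if "(n, i) \<in> {(1, 1), (2, 2)}"
  proof -
    have D1: "weight n \<D> \<le> 1" using that d by auto
    with le have "weight n \<L> = 0" by simp
    with D1 show ?thesis by simp
  qed
  show "3 * weight n \<L> + weight n \<D> \<le> 9" if ni: "(n, i) = (3, 2)"
  proof -
    have "finite F" using F(2) Pow_card_props(1) by blast
    have "F \<noteq> {1..n}" using F(3) ni by auto
    then obtain k where k: "k \<in> {1..n} - F" using F(2) by blast
    then have "insert k F \<in> \<L>" using up F(1) by blast
    moreover have "insert k F = {1..n}"
      using F k ni \<open>finite F\<close> by (intro card_subset_eq) auto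
    \<comment> \<open>Parity lowers the bound on \<open>weight n \<L>\<close> from 2 to 1. The
      resulting total 9 is attained by the sets meeting {1..4} in at least 3 elements, so there is
      no slack here.\<close>
    ultimately have "odd (weight n \<L>)" using weight_odd[OF L] by simp
    moreover have "weight n \<D> \<le> 6" using ni d by (simp add: numeral_eq_Suc)
    moreover from this le have "weight n \<L> \<le> 2" by simp
    ultimately have "weight n \<L> \<noteq> 2" by auto
    with \<open>weight n \<L> \<le> 2\<close> \<open>weight n \<D> \<le> 6\<close> show ?thesis by linarith
  qed
qed

lemma pivotal_sizes:
  fixes n i j :: nat
  assumes "3 * n \<le> 5 * i + 2" "3 * n \<le> 5 * j + 2" "i + j = Suc n" "i \<le> n" "j \<le> n"
    "(n, i) \<notin> {(9, 5), (7, 4), (4, 2)}" "(n, j) \<notin> {(9, 5), (7, 4), (4, 2)}"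
  shows "(n, i, j) \<in> {(1, 1, 1), (2, 1, 2), (2, 2, 1), (3, 2, 2), (5, 3, 3)}"
proof -
  \<comment> \<open>Adding the two size bounds gives 6n \<le> 5(n + 1) + 4, hence n \<le> 9, and the
    rest is a finite check.\<close>
  have n: "n \<in> set [0..<10]" using assms(1-3) by simp
  have j: "j = Suc n - i" and i: "i \<in> set [0..<Suc n]" using assms by auto
  have *: "\<forall>n\<in>set [0..<10]. \<forall>i\<in>set [0..<Suc n]. 3 * n \<le> 5 * i + 2 \<longrightarrow> 3 * n \<le> 5 * (Suc n - i) + 2 \<longrightarrow> Suc n - i \<le> n \<longrightarrow>
     (n, i) \<notin> {(9, 5), (7, 4), (4, 2)} \<longrightarrow> (n, Suc n - i) \<notin> {(9, 5), (7, 4), (4, 2)} \<longrightarrow>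
     (n, i, Suc n - i) \<in> {(1, 1, 1), (2, 1, 2), (2, 2, 1), (3, 2, 2), (5, 3, 3)}"
    by code_simp
  show ?thesis
    using *[rule_format, OF n i, folded j, OF assms(1,2,5,6,7)] .
qed
lemma pivotal_case:
  assumes opt: "optimal (Suc n) \<A> \<B>" and st: "shift_stable n \<A>" "shift_stable n \<B>"
    and pos: "0 < weight (Suc n) \<A>" "0 < weight (Suc n) \<B>"
    and F: "F \<in> hi n \<A> - lo n \<A>"
  shows "81 * (weight (Suc n) \<A> * weight (Suc n) \<B>) \<le> 9 ^ Suc n"
proof -
  note sub = optimalD(1,2)[OF opt]
  define i where "i = card F"
  define j where "j = Suc n - i"
  have "F \<in> Pow {1..n}" using F hi_subset[OF sub(1)] by auto
  from Pow_card_props(2)[OF this] have i: "i \<le> n" by (simp add: i_def)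
  then have ij: "i + j = Suc n" by (simp add: j_def)
  have ne: "piv n i \<A> \<noteq> {}" using F by (auto simp: piv_def i_def)
  note half = piv_half[OF opt st pos ne ij]
  \<comment> \<open>The pivotal part of \<open>\<B>\<close> carries at least half of a positive
    weight, so \<open>\<B>\<close> has pivotal sets too and both families can be treated
    alike.\<close>
  have "piv n j \<B> \<noteq> {}" using half(2) pos(2) by (auto simp: weight_def)
  then obtain G where G: "G \<in> hi n \<B> - lo n \<B>" "card G = j" by (auto simp: piv_def)
  have pA: "piv n i \<A> = hi n \<A> - lo n \<A>"
    using piv_single_size[OF opt st pos F] by (auto simp: piv_def i_def)
  have pB: "piv n j \<B> = hi n \<B> - lo n \<B>"
    using piv_single_size[OF optimal_commute[OF opt] st(2,1) pos(2,1) G(1)] G(2) by (auto simp: piv_def)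
  have loA: "lo n \<A> \<subseteq> hi n \<A>" and loB: "lo n \<B> \<subseteq> hi n \<B>"
    using lo_subset_hi[OF opt pos(2)] lo_subset_hi[OF optimal_commute[OF opt] pos(1)] by auto
  have wA: "weight (Suc n) \<A> = 3 * weight n (lo n \<A>) + weight n (piv n i \<A>)"
    using weight_lo_hi[OF sub(1) loA] pA by simp
  have wB: "weight (Suc n) \<B> = 3 * weight n (lo n \<B>) + weight n (piv n j \<B>)"
    using weight_lo_hi[OF sub(2) loB] pB by simp
  have leA: "3 * weight n (lo n \<A>) \<le> weight n (piv n i \<A>)" using half(1) wA by simp
  have leB: "3 * weight n (lo n \<B>) \<le> weight n (piv n j \<B>)" using half(2) wB by simp
  have upA: "\<forall>H\<in>piv n i \<A> \<union> lo n \<A>. \<forall>k\<in>{1..n} - H. insert k H \<in> lo n \<A>"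
    using st(1) loA by (auto simp: shift_stable_def piv_def)
  have upB: "\<forall>H\<in>piv n j \<B> \<union> lo n \<B>. \<forall>k\<in>{1..n} - H. insert k H \<in> lo n \<B>"
    using st(2) loB by (auto simp: shift_stable_def piv_def)
  have psA: "piv n i \<A> \<subseteq> {F \<in> Pow {1..n}. card F = i}" and psB: "piv n j \<B> \<subseteq> {F \<in> Pow {1..n}. card F = j}"
    using piv_subset[OF sub(1), of i] piv_subset[OF sub(2), of j] by (auto simp: piv_def)
  note A = level_weight[OF lo_subset[OF sub(1)] psA ne upA leA, folded wA]
  note B = level_weight[OF lo_subset[OF sub(2)] psB \<open>piv n j \<B> \<noteq> {}\<close> upB leB, folded wB]
  have "G \<in> Pow {1..n}" using G hi_subset[OF sub(2)] by auto
  from Pow_card_props(2)[OF this] have j: "j \<le> n" using G by simp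
  have "(n, i, j) \<in> {(1, 1, 1), (2, 1, 2), (2, 2, 1), (3, 2, 2), (5, 3, 3)}"
    by (rule pivotal_sizes[OF A(1) B(1) ij i j A(2) B(2)])
  then consider "(n, i, j) = (1, 1, 1)" | "(n, i, j) = (2, 1, 2)" | "(n, i, j) = (2, 2, 1)"
    | "(n, i, j) = (3, 2, 2)" | "(n, i, j) = (5, 3, 3)" by blast
  then show ?thesis
  proof cases
    case 1
    then show ?thesis using mult_le_mono[OF A(6) B(6)] by simp
  next
    case 2
    then show ?thesis using mult_le_mono[OF A(5) B(6)] by simp
  next
    case 3
    then show ?thesis using mult_le_mono[OF A(6) B(5)] by simp
  next
    case 4
    then show ?thesis using mult_le_mono[OF A(4) B(4)] by simp
  next
    case 5
    then show ?thesis using mult_le_mono[OF A(3) B(3)] by simp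
  qed
qed

text \<open>This is the bound 1/81 with each measure scaled by \<open>3 ^ n\<close>. In the
  inductive step it suffices to treat one optimal stable pair instead of the given families.\<close>

lemma weight_mult_le:
  assumes "\<A> \<subseteq> Pow {1..n}" "\<B> \<subseteq> Pow {1..n}" "cross_intersecting 2 \<A> \<B>"
  shows "81 * (weight n \<A> * weight n \<B>) \<le> 9 ^ n"
  using assms
proof (induction n arbitrary: \<A> \<B>)
  case 0
  have "\<A> = {} \<or> \<B> = {}"
  proof (rule ccontr)
    assume "\<not> ?thesis"
    then have "{} \<in> \<A>" "{} \<in> \<B>" using 0 by auto
    then show False using 0(3) by (auto simp: cross_intersecting_def)
  qed
  then show ?case by (auto simp: weight_def)
next
  case (Suc n)
  obtain \<X> \<Y> where opt: "optimal (Suc n) \<X> \<Y>" and st: "shift_stable n \<X>" "shift_stable n \<Y>"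
    by (rule ex_optimal_stable)
  note sub = optimalD(1,2)[OF opt]
  have "81 * (weight (Suc n) \<X> * weight (Suc n) \<Y>) \<le> 9 ^ Suc n"
  proof (cases "0 < weight (Suc n) \<X> \<and> 0 < weight (Suc n) \<Y>")
    case True
    then have pos: "0 < weight (Suc n) \<X>" "0 < weight (Suc n) \<Y>" by auto
    note lo_hi = lo_subset_hi[OF opt pos(2)] lo_subset_hi[OF optimal_commute[OF opt] pos(1)]
    consider F where "F \<in> hi n \<X> - lo n \<X>" | F where "F \<in> hi n \<Y> - lo n \<Y>"
      | "hi n \<X> = lo n \<X>" "hi n \<Y> = lo n \<Y>"
      using lo_hi by blast
    then show ?thesis
    proof cases
      case 1
      then show ?thesis by (rule pivotal_case[OF opt st pos])
    next
      case 2
      then show ?thesis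
        using pivotal_case[OF optimal_commute[OF opt] st(2,1) pos(2,1)] by (simp only: mult.commute)
    next
      case 3
      have "cross_intersecting 2 (lo n \<X>) (lo n \<Y>)"
        using optimalD(3)[OF opt] by (simp add: cross_intersecting_def lo_def)
      then have "81 * (weight n (lo n \<X>) * weight n (lo n \<Y>)) \<le> 9 ^ n"
        by (intro Suc.IH lo_subset sub)
      \<comment> \<open>Without pivotal sets both slices agree, so each weight is three times that
        of its slice, which accounts for the new factor 9.\<close>
      then show ?thesis
        using weight_Suc[OF sub(1)] weight_Suc[OF sub(2)] 3 by simp
    qed
  qed auto
  with optimal_le[OF opt Suc.prems] show ?case by linarith
qed

section \<open>Changing the probability\<close>

definition up_closed :: "nat \<Rightarrow> nat set set \<Rightarrow> bool" where
  "up_closed n \<A> \<longleftrightarrow> \<A> \<subseteq> Pow {1..n} \<and> (\<forall>F\<in>\<A>. \<forall>G\<in>Pow {1..n}. F \<subseteq> G \<longrightarrow> G \<in> \<A>)"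

lemma up_closedD: "up_closed n \<A> \<Longrightarrow> F \<in> \<A> \<Longrightarrow> F \<subseteq> G \<Longrightarrow> G \<subseteq> {1..n} \<Longrightarrow> G \<in> \<A>"
  by (simp add: up_closed_def)

lemma up_closed_subset: "up_closed n \<A> \<Longrightarrow> \<A> \<subseteq> Pow {1..n}"
  by (simp add: up_closed_def)

lemma up_closed_lo:
  assumes "up_closed (Suc n) \<A>"
  shows "up_closed n (lo n \<A>)"
  unfolding up_closed_def
proof (intro conjI ballI impI)
  fix F G assume FG: "F \<in> lo n \<A>" "G \<in> Pow {1..n}" "F \<subseteq> G"
  have "G \<in> \<A>" by (rule up_closedD[OF assms, of F]) (use FG in \<open>auto simp: lo_def\<close>)
  then show "G \<in> lo n \<A>" using FG(2) by (auto simp: lo_def)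
qed (use lo_subset[OF up_closed_subset[OF assms]] in simp)

lemma up_closed_hi:
  assumes "up_closed (Suc n) \<A>"
  shows "up_closed n (hi n \<A>)"
  unfolding up_closed_def
proof (intro conjI ballI impI)
  fix F G assume FG: "F \<in> hi n \<A>" "G \<in> Pow {1..n}" "F \<subseteq> G"
  have "insert (Suc n) G \<in> \<A>"
    by (rule up_closedD[OF assms, of "insert (Suc n) F"]) (use FG in \<open>auto simp: hi_def\<close>)
  then show "G \<in> hi n \<A>" using FG(2) by (auto simp: hi_def)
qed (use hi_subset[OF up_closed_subset[OF assms]] in simp)

lemma up_closed_lo_subset_hi:
  assumes "up_closed (Suc n) \<A>"
  shows "lo n \<A> \<subseteq> hi n \<A>"
proof
  fix F assume F: "F \<in> lo n \<A>"
  have "insert (Suc n) F \<in> \<A>"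
    by (rule up_closedD[OF assms, of F]) (use F up_closed_subset[OF assms] in \<open>auto simp: lo_def\<close>)
  then show "F \<in> hi n \<A>" using F by (simp add: lo_def hi_def)
qed

lemma product_measure_nonneg: "0 \<le> p \<Longrightarrow> p \<le> 1 \<Longrightarrow> 0 \<le> product_measure n p \<A>"
  by (auto simp: product_measure_def intro!: sum_nonneg)

lemma product_measure_mono:
  assumes "0 \<le> p" "p \<le> 1" "\<A> \<subseteq> \<B>" "\<B> \<subseteq> Pow {1..n}"
  shows "product_measure n p \<A> \<le> product_measure n p \<B>"
  unfolding product_measure_def using assms by (intro sum_mono2) (auto intro: finite_subset)

lemma product_measure_strict_mono:
  assumes p: "0 < p" "p < 1" and sub: "\<A> \<subset> \<B>" "\<B> \<subseteq> Pow {1..n}"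
  shows "product_measure n p \<A> < product_measure n p \<B>"
proof -
  obtain F where "F \<in> \<B> - \<A>" using sub by blast
  then show ?thesis
    unfolding product_measure_def using sub p
    by (intro sum_strict_mono2[where b = F]) (auto intro: finite_subset)
qed

text \<open>By convexity, the increment of \<open>x \<mapsto> x powr s\<close> over \<open>[p y, p x]\<close> is at most the one over
  \<open>[y, p x + (1 - p) y]\<close>: both intervals have length \<open>p (x - y)\<close>.\<close>

lemma powr_mix_strict:
  fixes p x y s :: real
  assumes p: "0 < p" "p < 1" and xy: "0 < y" "y < x" and s: "1 < s"
  shows "p powr s * x powr s + (1 - p powr s) * y powr s < ((1 - p) * y + p * x) powr s"
proof -
  define d where "d = p * (x - y)"
  define h where "h = (\<lambda>t. (t + d) powr s - t powr s)"
  have d: "0 < d" using p xy by (simp add: d_def)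
  have "h (p * y) < h y"
  proof (rule DERIV_pos_imp_increasing[of "p * y" y h])
    show "p * y < y" using p xy by simp
    fix t assume t: "p * y \<le> t" "t \<le> y"
    then have "0 < t" using p xy by (meson less_le_trans mult_pos_pos)
    then have "(h has_real_derivative s * (t + d) powr (s - 1) - s * t powr (s - 1)) (at t)"
      unfolding h_def using d by (auto intro!: derivative_eq_intros)
    moreover have "s * t powr (s - 1) < s * (t + d) powr (s - 1)"
      using \<open>0 < t\<close> d s by (simp add: powr_less_mono2)
    ultimately show "\<exists>D. (h has_real_derivative D) (at t) \<and> 0 < D" by force
  qed
  moreover have "p * y + d = p * x" "y + d = (1 - p) * y + p * x"
    by (simp_all add: d_def algebra_simps)
  ultimately have "(p * x) powr s - (p * y) powr s < ((1 - p) * y + p * x) powr s - y powr s"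
    by (simp only: h_def)
  moreover have "(p * x) powr s = p powr s * x powr s" "(p * y) powr s = p powr s * y powr s"
    using p xy by (simp_all add: powr_mult)
  moreover have "(1 - p powr s) * y powr s = y powr s - p powr s * y powr s"
    by (simp add: left_diff_distrib)
  ultimately show ?thesis by linarith
qed

lemma powr_mix_le:
  fixes p x y s :: real
  assumes p: "0 < p" "p < 1" and xy: "0 \<le> y" "y \<le> x" and s: "1 \<le> s"
  shows "p powr s * x powr s + (1 - p powr s) * y powr s \<le> ((1 - p) * y + p * x) powr s"
proof -
  consider "s = 1" | "y = 0" | "y = x" | "1 < s" "0 < y" "y < x" using s xy by linarith
  then show ?thesis
  proof cases
    case 1
    then show ?thesis using p xy by simp
  next
    case 2
    then show ?thesis using p xy by (simp add: powr_mult)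
  next
    case 3
    then show ?thesis by (simp add: algebra_simps)
  next
    case 4
    then show ?thesis using powr_mix_strict[OF p] by (simp add: less_imp_le)
  qed
qed

text \<open>Induction on the dimension: the two slices satisfy the claim, and
  \<open>powr_mix_le\<close> recombines them, the larger value belonging to the upper slice by
  up-closedness. The equality case is carried along, since it needs equality in the upper slice as
  well as in the convexity step.\<close>

lemma product_measure_powr_le:
  assumes p: "0 < p" "p < 1" and s: "1 \<le> s" and up: "up_closed n \<A>"
  shows "product_measure n (p powr s) \<A> \<le> product_measure n p \<A> powr s"
    and "1 < s \<Longrightarrow> \<A> \<noteq> {} \<Longrightarrow> product_measure n (p powr s) \<A> = product_measure n p \<A> powr s \<Longrightarrow>
      \<exists>S \<subseteq> {1..n}. \<A> = {F \<in> Pow {1..n}. S \<subseteq> F}"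
proof -
  have q: "0 < p powr s" "p powr s < 1" using p s powr_less_mono2[of s p 1] by auto
  note [simp] = product_measure_nonneg
  have "product_measure n (p powr s) \<A> \<le> product_measure n p \<A> powr s \<and>
    (1 < s \<longrightarrow> \<A> \<noteq> {} \<longrightarrow> product_measure n (p powr s) \<A> = product_measure n p \<A> powr s \<longrightarrow>
      (\<exists>S \<subseteq> {1..n}. \<A> = {F \<in> Pow {1..n}. S \<subseteq> F}))"
    using up
  proof (induction n arbitrary: \<A>)
    case 0
    then have "\<A> = {} \<or> \<A> = {{}}" by (auto simp: up_closed_def)
    then show ?case by (auto simp: product_measure_def)
  next
    case (Suc n)
    let ?L = "lo n \<A>" and ?H = "hi n \<A>"
    have sub: "\<A> \<subseteq> Pow {1..Suc n}" using Suc.prems by (simp add: up_closed_def)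
    note IHL = Suc.IH[OF up_closed_lo[OF Suc.prems]] and IHH = Suc.IH[OF up_closed_hi[OF Suc.prems]]
    define x y x' y' where defs: "x = product_measure n p ?H" "y = product_measure n p ?L"
      "x' = product_measure n (p powr s) ?H" "y' = product_measure n (p powr s) ?L"
    have LH: "?L \<subseteq> ?H" using Suc.prems by (rule up_closed_lo_subset_hi)
    have y0: "0 \<le> y" using p by (simp add: defs)
    have yx: "y \<le> x" using product_measure_mono[OF _ _ LH hi_subset[OF sub]] p by (simp add: defs)
    have le: "x' \<le> x powr s" "y' \<le> y powr s" using IHL IHH by (auto simp: defs)
    have m: "product_measure (Suc n) p \<A> = (1 - p) * y + p * x"
      "product_measure (Suc n) (p powr s) \<A> = (1 - p powr s) * y' + p powr s * x'"
      by (simp_all add: defs product_measure_Suc[OF sub])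
    have le1: "p powr s * x' \<le> p powr s * x powr s" "(1 - p powr s) * y' \<le> (1 - p powr s) * y powr s"
      using le q by (auto intro: mult_left_mono)
    note mix = powr_mix_le[OF p y0 yx s]
    have "(1 - p powr s) * y' + p powr s * x' \<le> ((1 - p) * y + p * x) powr s"
      using le1 mix by linarith
    moreover have "\<exists>S \<subseteq> {1..Suc n}. \<A> = {F \<in> Pow {1..Suc n}. S \<subseteq> F}"
      if s1: "1 < s" and ne: "\<A> \<noteq> {}"
        and eq: "(1 - p powr s) * y' + p powr s * x' = ((1 - p) * y + p * x) powr s"
    proof -
      have "p powr s * x' = p powr s * x powr s" using le1 mix eq by linarith
      then have x': "x' = x powr s" using q by simp
      have "?H \<noteq> {}" using ne LH lo_hi_decomp[of \<A> n] by auto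
      then obtain S where S: "S \<subseteq> {1..n}" "?H = {F \<in> Pow {1..n}. S \<subseteq> F}"
        using IHH s1 x' by (auto simp: defs)
      \<comment> \<open>Strict convexity excludes 0 < y < x. As the measure is strictly monotone,
        either the lower slice is empty, and \<open>Suc n\<close> joins the kernel \<open>S\<close>,
        or the slices coincide, and \<open>S\<close> remains the kernel.\<close>
      have "y = 0 \<or> y = x"
        using powr_mix_strict[OF p _ _ s1, of y x] le1 mix eq y0 yx by linarith
      moreover have "y \<noteq> 0" if "{} \<subset> ?L"
        using product_measure_strict_mono[OF p that lo_subset[OF sub]]
        unfolding defs by (simp add: product_measure_def)
      moreover have "y \<noteq> x" if "?L \<subset> ?H"
        using product_measure_strict_mono[OF p that hi_subset[OF sub]] unfolding defs by simp
      ultimately have "\<not> {} \<subset> ?L \<or> \<not> ?L \<subset> ?H" by metis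
      then consider "?L = {}" | "?L = ?H" using LH by blast
      then show ?thesis
      proof cases
        case 1
        then have "\<A> = insert (Suc n) ` {F \<in> Pow {1..n}. S \<subseteq> F}"
          using lo_hi_decomp[of \<A> n] S(2) by simp
        also have "\<dots> = {F \<in> Pow {1..Suc n}. insert (Suc n) S \<subseteq> F}"
        proof (intro set_eqI iffI)
          fix F assume F: "F \<in> {F \<in> Pow {1..Suc n}. insert (Suc n) S \<subseteq> F}"
          then have "F = insert (Suc n) (F - {Suc n})" "F - {Suc n} \<in> {F \<in> Pow {1..n}. S \<subseteq> F}"
            using S(1) by (auto simp: atLeastAtMostSuc_conv)
          then show "F \<in> insert (Suc n) ` {F \<in> Pow {1..n}. S \<subseteq> F}" by (rule image_eqI)
        qed auto
        finally have "\<A> = {F \<in> Pow {1..Suc n}. insert (Suc n) S \<subseteq> F}" .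
        moreover have "insert (Suc n) S \<subseteq> {1..Suc n}" using S(1) by auto
        ultimately show ?thesis by (intro exI conjI)
      next
        case 2
        then have "\<A> = {F \<in> Pow {1..n}. S \<subseteq> F} \<union> insert (Suc n) ` {F \<in> Pow {1..n}. S \<subseteq> F}"
          using lo_hi_decomp[of \<A> n] S(2) by simp
        also have "\<dots> = {F \<in> Pow {1..Suc n}. S \<subseteq> F}"
        proof (intro set_eqI iffI)
          fix F assume F: "F \<in> {F \<in> Pow {1..Suc n}. S \<subseteq> F}"
          show "F \<in> {F \<in> Pow {1..n}. S \<subseteq> F} \<union> insert (Suc n) ` {F \<in> Pow {1..n}. S \<subseteq> F}"
          proof (cases "Suc n \<in> F")
            case True
            then have "F = insert (Suc n) (F - {Suc n})" "F - {Suc n} \<in> {F \<in> Pow {1..n}. S \<subseteq> F}"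
              using S(1) F by (auto simp: atLeastAtMostSuc_conv)
            then show ?thesis by (intro UnI2 image_eqI)
          qed (use F in \<open>auto simp: atLeastAtMostSuc_conv\<close>)
        qed auto
        finally have "\<A> = {F \<in> Pow {1..Suc n}. S \<subseteq> F}" .
        moreover have "S \<subseteq> {1..Suc n}" using S(1) by auto
        ultimately show ?thesis by (intro exI conjI)
      qed
    qed
    ultimately show ?case unfolding m by blast
  qed
  then show "product_measure n (p powr s) \<A> \<le> product_measure n p \<A> powr s"
    and "1 < s \<Longrightarrow> \<A> \<noteq> {} \<Longrightarrow> product_measure n (p powr s) \<A> = product_measure n p \<A> powr s \<Longrightarrow>
      \<exists>S \<subseteq> {1..n}. \<A> = {F \<in> Pow {1..n}. S \<subseteq> F}"
    by auto
qed

section \<open>From the probability 1/3 to smaller probabilities\<close>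

lemma third_product_le:
  assumes "\<A> \<subseteq> Pow {1..n}" "\<B> \<subseteq> Pow {1..n}" "cross_intersecting 2 \<A> \<B>"
  shows "product_measure n (1/3) \<A> * product_measure n (1/3) \<B> \<le> 1 / 81"
proof -
  have "real (81 * (weight n \<A> * weight n \<B>)) \<le> real (9 ^ n)"
    using weight_mult_le[OF assms] by (simp only: of_nat_le_iff)
  moreover have "(9::real) ^ n = 3 ^ n * 3 ^ n" by (simp flip: power_mult_distrib)
  ultimately show ?thesis
    by (simp add: product_measure_third[OF assms(1)] product_measure_third[OF assms(2)] field_simps)
qed

text \<open>With s = log_{1/3} p, the bound 1/81 at 1/3 turns into (1/81)^s = p^4. For p < 1/3 the
  exponent exceeds 1, so the equality case of the transfer applies to each family separately; it
  does not yet relate the two kernels.\<close>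

lemma up_closed_product_le:
  assumes p: "0 < p" "p \<le> 1/3" and up: "up_closed n \<A>" "up_closed n \<B>"
    and cross: "cross_intersecting 2 \<A> \<B>"
  shows "product_measure n p \<A> * product_measure n p \<B> \<le> p ^ 4"
    and "p < 1/3 \<Longrightarrow> product_measure n p \<A> * product_measure n p \<B> = p ^ 4 \<Longrightarrow>
      \<exists>S T. S \<subseteq> {1..n} \<and> T \<subseteq> {1..n} \<and> \<A> = {F \<in> Pow {1..n}. S \<subseteq> F} \<and> \<B> = {F \<in> Pow {1..n}. T \<subseteq> F}"
proof -
  let ?P = "product_measure n p" and ?Q = "product_measure n (1/3)"
  define s where "s = log (1/3) p"
  have ps: "(1/3) powr s = p" using p by (simp add: s_def)
  have s1: "1 \<le> s"
  proof (rule ccontr)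
    assume "\<not> 1 \<le> s"
    then have "(1/3::real) powr 1 < (1/3) powr s" by (intro powr_less_mono') auto
    then show False using ps p by simp
  qed
  have third: "(0::real) < 1/3" "(1/3::real) < 1" by simp_all
  note le = product_measure_powr_le(1)[OF third s1 up(1), unfolded ps]
    product_measure_powr_le(1)[OF third s1 up(2), unfolded ps]
  have nn: "0 \<le> ?P \<A>" "0 \<le> ?P \<B>" "0 \<le> ?Q \<A>" "0 \<le> ?Q \<B>"
    using p by (simp_all add: product_measure_nonneg)
  have "(1/81::real) powr s = ((1/3) powr 4) powr s" by (simp add: power_divide)
  also have "\<dots> = ((1/3) powr s) powr 4" by (simp only: powr_powr mult.commute)
  also have "\<dots> = p ^ 4" using p ps by simp
  finally have p4: "(1/81::real) powr s = p ^ 4" .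
  have "(?Q \<A> * ?Q \<B>) powr s \<le> (1/81) powr s"
    using third_product_le[OF up_closed_subset[OF up(1)] up_closed_subset[OF up(2)] cross] nn s1
    by (intro powr_mono2) auto
  then have Q: "?Q \<A> powr s * ?Q \<B> powr s \<le> p ^ 4"
    using nn p4 by (simp add: powr_mult)
  have "?P \<A> * ?P \<B> \<le> ?Q \<A> powr s * ?Q \<B> powr s"
    using le nn by (intro mult_mono) auto
  then show "?P \<A> * ?P \<B> \<le> p ^ 4" using Q by linarith
  show "\<exists>S T. S \<subseteq> {1..n} \<and> T \<subseteq> {1..n} \<and> \<A> = {F \<in> Pow {1..n}. S \<subseteq> F} \<and> \<B> = {F \<in> Pow {1..n}. T \<subseteq> F}"
    if p3: "p < 1/3" and eq: "?P \<A> * ?P \<B> = p ^ 4"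
  proof -
    have "s \<noteq> 1" using ps p3 by auto
    with s1 have s1': "1 < s" by simp
    have "?P \<A> * ?P \<B> > 0" using eq p by simp
    then have pos: "0 < ?P \<A>" "0 < ?P \<B>" using nn by (auto simp: zero_less_mult_iff)
    then have ne: "\<A> \<noteq> {}" "\<B> \<noteq> {}" by (auto simp: product_measure_def)
    \<comment> \<open>All factors are positive, so strictness in one family would make the product
      fall strictly below \<open>p ^ 4\<close>.\<close>
    have "\<not> ?P \<A> < ?Q \<A> powr s"
    proof
      assume "?P \<A> < ?Q \<A> powr s"
      then have "?P \<A> * ?P \<B> < ?Q \<A> powr s * ?Q \<B> powr s"
        using le(2) pos by (intro mult_less_le_imp_less) auto
      then show False using Q eq by linarith
    qed
    moreover have "\<not> ?P \<B> < ?Q \<B> powr s"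
    proof
      assume "?P \<B> < ?Q \<B> powr s"
      then have "?P \<A> * ?P \<B> < ?Q \<A> powr s * ?Q \<B> powr s"
        using le(1) pos by (intro mult_le_less_imp_less) auto
      then show False using Q eq by linarith
    qed
    ultimately have eqs: "?P \<A> = ?Q \<A> powr s" "?P \<B> = ?Q \<B> powr s" using le by linarith+
    from product_measure_powr_le(2)[OF third s1 up(1) s1' ne(1), unfolded ps, OF eqs(1)]
    obtain S where S: "S \<subseteq> {1..n}" "\<A> = {F \<in> Pow {1..n}. S \<subseteq> F}" by (elim exE conjE)
    from product_measure_powr_le(2)[OF third s1 up(2) s1' ne(2), unfolded ps, OF eqs(2)]
    obtain T where T: "T \<subseteq> {1..n}" "\<B> = {F \<in> Pow {1..n}. T \<subseteq> F}" by (elim exE conjE)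
    from S T show ?thesis by (intro exI[of _ S] exI[of _ T] conjI)
  qed
qed

section \<open>Reduction of arbitrary families to their up-closures\<close>

definition up_closure :: "nat \<Rightarrow> nat set set \<Rightarrow> nat set set" where
  "up_closure n \<A> = {G \<in> Pow {1..n}. \<exists>F\<in>\<A>. F \<subseteq> G}"

lemma up_closed_up_closure: "up_closed n (up_closure n \<A>)"
  unfolding up_closed_def
proof (intro conjI ballI impI)
  fix F G assume "F \<in> up_closure n \<A>" "G \<in> Pow {1..n}" "F \<subseteq> G"
  then show "G \<in> up_closure n \<A>" unfolding up_closure_def by (simp, meson subset_trans)
qed (auto simp: up_closure_def)

lemma subset_up_closure: "\<A> \<subseteq> Pow {1..n} \<Longrightarrow> \<A> \<subseteq> up_closure n \<A>"
  by (auto simp: up_closure_def)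

lemma cross_intersecting_up_closure:
  assumes "cross_intersecting t \<A> \<B>"
  shows "cross_intersecting t (up_closure n \<A>) (up_closure n \<B>)"
  unfolding cross_intersecting_def
proof (intro ballI)
  fix F' G' assume F': "F' \<in> up_closure n \<A>" and G': "G' \<in> up_closure n \<B>"
  then obtain F G where FG: "F \<in> \<A>" "F \<subseteq> F'" "G \<in> \<B>" "G \<subseteq> G'"
    by (auto simp: up_closure_def)
  have "F' \<in> Pow {1..n}" using F' by (simp add: up_closure_def)
  then have "finite F'" by (rule Pow_card_props(1))
  have "t \<le> card (F \<inter> G)" using assms FG(1,3) by (rule cross_intersectingD)
  also have "\<dots> \<le> card (F' \<inter> G')" using FG \<open>finite F'\<close> by (intro card_mono) auto
  finally show "t \<le> card (F' \<inter> G')" .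
qed

text \<open>Identifies the families without computing the measure of \<open>\<C>\<close>: if one
  factor is a proper subfamily, the product of the two measures is strictly below the
  square.\<close>

lemma eq_if_product_measure_ge:
  assumes p: "0 < p" "p < 1" and sub: "\<A> \<subseteq> \<C>" "\<B> \<subseteq> \<C>" "\<C> \<subseteq> Pow {1..n}"
    and le: "product_measure n p \<C> * product_measure n p \<C> \<le> product_measure n p \<A> * product_measure n p \<B>"
  shows "\<A> = \<C>"
proof (rule ccontr)
  let ?P = "product_measure n p"
  assume "\<A> \<noteq> \<C>"
  then have less: "?P \<A> < ?P \<C>" using sub by (intro product_measure_strict_mono p) auto
  have nn: "0 \<le> ?P \<A>" using p by (simp add: product_measure_nonneg)
  have "?P \<A> * ?P \<B> \<le> ?P \<A> * ?P \<C>"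
    using p sub nn by (intro mult_left_mono product_measure_mono) auto
  also have "\<dots> < ?P \<C> * ?P \<C>" using less nn by (intro mult_strict_right_mono) auto
  finally show False using le by simp
qed

theorem theorem1p6:
  fixes p :: real and n :: nat and \<F> \<G> :: "nat set set"
  assumes "0 < p" and "p \<le> 1 / 3" and "1 \<le> n"
    and "\<F> \<subseteq> Pow {1..n}" and "\<G> \<subseteq> Pow {1..n}"
    and "cross_intersecting 2 \<F> \<G>"
  shows "product_measure n p \<F> * product_measure n p \<G> \<le> p ^ 4 \<and>
    (p < 1 / 3 \<longrightarrow> product_measure n p \<F> * product_measure n p \<G> = p ^ 4 \<longrightarrow>
      (\<exists>T. T \<subseteq> {1..n} \<and> card T = 2 \<and>
        \<F> = {F \<in> Pow {1..n}. T \<subseteq> F} \<and> \<G> = {F \<in> Pow {1..n}. T \<subseteq> F}))"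
proof (intro conjI impI)
  let ?P = "product_measure n p" and ?U = "up_closure n"
  have p1: "p < 1" using assms(2) by simp
  note sub = subset_up_closure[OF assms(4)] subset_up_closure[OF assms(5)]
  note up = up_closed_up_closure[of n \<F>] up_closed_up_closure[of n \<G>]
  note crossU = cross_intersecting_up_closure[OF assms(6), of n]
  note main = up_closed_product_le[OF assms(1,2) up crossU]
  have "?P \<F> * ?P \<G> \<le> ?P (?U \<F>) * ?P (?U \<G>)"
    using assms(1) p1 sub up_closed_subset[OF up(1)] up_closed_subset[OF up(2)]
    by (intro mult_mono product_measure_mono product_measure_nonneg) auto
  then show le: "?P \<F> * ?P \<G> \<le> p ^ 4" using main(1) by linarith
  assume p3: "p < 1 / 3" and eq: "?P \<F> * ?P \<G> = p ^ 4"
  have "?P (?U \<F>) * ?P (?U \<G>) = p ^ 4"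
    using \<open>?P \<F> * ?P \<G> \<le> ?P (?U \<F>) * ?P (?U \<G>)\<close> main(1) eq by linarith
  from main(2)[OF p3 this] obtain S T where S: "S \<subseteq> {1..n}" "?U \<F> = {F \<in> Pow {1..n}. S \<subseteq> F}"
    and T: "T \<subseteq> {1..n}" "?U \<G> = {F \<in> Pow {1..n}. T \<subseteq> F}" by auto
  \<comment> \<open>The kernels are themselves members of the closures, so cross-intersection makes
    them share a 2-element set \<open>W\<close>. Both closures then lie inside the family of all
    supersets of \<open>W\<close>.\<close>
  have "S \<in> ?U \<F>" "T \<in> ?U \<G>" unfolding S(2) T(2) using S(1) T(1) by auto
  with crossU have "2 \<le> card (S \<inter> T)" by (rule cross_intersectingD)
  then obtain W where W: "W \<subseteq> S \<inter> T" "card W = 2" by (meson obtain_subset_with_card_n)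
  let ?C = "{F \<in> Pow {1..n}. W \<subseteq> F}"
  have FC: "\<F> \<subseteq> ?C" "\<G> \<subseteq> ?C" 
    using subset_trans[OF sub(1), of ?C] subset_trans[OF sub(2), of ?C] W(1)
    unfolding S(2) T(2) by blast+
  have "cross_intersecting 2 ?C ?C"
    unfolding cross_intersecting_def
  proof (intro ballI)
    fix F G assume "F \<in> ?C" "G \<in> ?C"
    then have "W \<subseteq> F \<inter> G" "finite (F \<inter> G)" using finite_subset[of F "{1..n}"] by auto
    then show "2 \<le> card (F \<inter> G)" using card_mono W(2) by metis
  qed
  moreover have "up_closed n ?C" by (auto simp: up_closed_def)
  \<comment> \<open>The inequality already proved, applied to \<open>?C\<close> paired with itself,
    bounds its squared measure by \<open>p ^ 4\<close>, the product attained by the subfamilies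
    \<open>\<F>\<close> and \<open>\<G>\<close>; hence both equal \<open>?C\<close>.\<close>
  ultimately have "?P ?C * ?P ?C \<le> p ^ 4" by (intro up_closed_product_le assms)
  then have "?P ?C * ?P ?C \<le> ?P \<F> * ?P \<G>" "?P ?C * ?P ?C \<le> ?P \<G> * ?P \<F>"
    using eq by (simp_all add: mult.commute)
  then have "\<F> = ?C" "\<G> = ?C"
    using FC by (intro eq_if_product_measure_ge[OF assms(1) p1]; auto)+
  moreover have "W \<subseteq> {1..n}" using W(1) S(1) by blast
  ultimately show "\<exists>T. T \<subseteq> {1..n} \<and> card T = 2 \<and>
      \<F> = {F \<in> Pow {1..n}. T \<subseteq> F} \<and> \<G> = {F \<in> Pow {1..n}. T \<subseteq> F}"
    using W(2) by (intro exI[of _ W] conjI)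
qed

end
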